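(* Let $\gamma=\inf_{f\in\mathcal{T}}\mu_f$ be the harmonic John constant, where $\mathcal{T}=\mathcal{H}\setminus\mathcal{S}_{HU}$ is the set of non-constant harmonic mappings in $\mathbb{D}$ that are not univalent. Then $$e^{\pi/2}\leq\gamma\leq e^{\pi}.$$
   Context: $\mathbb{D}$ is the open unit disk. $\mathcal{H}$ denotes the set of all non-constant harmonic mappings (complex-valued harmonic functions) $f$ in $\mathbb{D}$, and $\mathcal{S}_{HU}$ the set of all univalent (injective) harmonic mappings in $\mathbb{D}$. For $f\in\mathcal{H}$ put, using Wirtinger derivatives, $$\Lambda_f(z)=|f_z(z)|+|f_{\overline z}(z)|,\qquad \lambda_f(z)=\big|\,|f_z(z)|-|f_{\overline z}(z)|\,\big|,$$ $$M_f=\sup_{z\in\mathbb{D}}\Lambda_f(z),\qquad m_f=\inf_{z\in\mathbb{D}}\lambda_f(z),\qquad \mu_f=\frac{M_f}{m_f},$$ with the convention $\mu_f=+\infty$ if $M_f=+\infty$ or $m_f=0$. *)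

theory Defs
  imports "HOL-Analysis.Analysis"
begin

definition partial_x :: "(complex \<Rightarrow> complex) \<Rightarrow> complex \<Rightarrow> complex" where
  "partial_x f z = frechet_derivative f (at z) 1"

definition partial_y :: "(complex \<Rightarrow> complex) \<Rightarrow> complex \<Rightarrow> complex" where
  "partial_y f z = frechet_derivative f (at z) \<i>"

text \<open>On type \<^typ>\<open>complex\<close>, \<open>differentiable\<close> means real (Frechet) differentiability.
  The set \<open>S\<close> is meant to be open, since all derivatives are two-sided.\<close>

definition C2_on :: "(complex \<Rightarrow> complex) \<Rightarrow> complex set \<Rightarrow> bool" where
  "C2_on f S \<longleftrightarrow>
     (\<forall>z\<in>S. f differentiable (at z)) \<and>
     (\<forall>z\<in>S. partial_x f differentiable (at z)) \<and>
     (\<forall>z\<in>S. partial_y f differentiable (at z)) \<and>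
     continuous_on S (partial_x (partial_x f)) \<and>
     continuous_on S (partial_x (partial_y f)) \<and>
     continuous_on S (partial_y (partial_x f)) \<and>
     continuous_on S (partial_y (partial_y f))"

definition harmonic_map_on :: "(complex \<Rightarrow> complex) \<Rightarrow> complex set \<Rightarrow> bool" where
  "harmonic_map_on f S \<longleftrightarrow>
     C2_on f S \<and> (\<forall>z\<in>S. partial_x (partial_x f) z + partial_y (partial_y f) z = 0)"

definition wirtinger_z :: "(complex \<Rightarrow> complex) \<Rightarrow> complex \<Rightarrow> complex" where
  "wirtinger_z f z = (partial_x f z - \<i> * partial_y f z) / 2"

definition wirtinger_zbar :: "(complex \<Rightarrow> complex) \<Rightarrow> complex \<Rightarrow> complex" where
  "wirtinger_zbar f z = (partial_x f z + \<i> * partial_y f z) / 2"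

abbreviation unit_disk :: "complex set" where
  "unit_disk \<equiv> ball 0 1"

text \<open>Mappings of the disk are represented by total functions on \<^typ>\<open>complex\<close>; the values
  outside the (open) disk affect none of the notions below.\<close>

definition nonconst_harmonic_maps :: "(complex \<Rightarrow> complex) set" where
  "nonconst_harmonic_maps =
     {f. harmonic_map_on f unit_disk \<and> \<not> f constant_on unit_disk}"

definition univalent_harmonic_maps :: "(complex \<Rightarrow> complex) set" where
  "univalent_harmonic_maps = {f. harmonic_map_on f unit_disk \<and> inj_on f unit_disk}"

definition Lambda_max :: "(complex \<Rightarrow> complex) \<Rightarrow> complex \<Rightarrow> real" where
  "Lambda_max f z = cmod (wirtinger_z f z) + cmod (wirtinger_zbar f z)"

definition lambda_min :: "(complex \<Rightarrow> complex) \<Rightarrow> complex \<Rightarrow> real" where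
  "lambda_min f z = \<bar>cmod (wirtinger_z f z) - cmod (wirtinger_zbar f z)\<bar>"

definition M_sup :: "(complex \<Rightarrow> complex) \<Rightarrow> ereal" where
  "M_sup f = (SUP z\<in>unit_disk. ereal (Lambda_max f z))"

definition m_inf :: "(complex \<Rightarrow> complex) \<Rightarrow> ereal" where
  "m_inf f = (INF z\<in>unit_disk. ereal (lambda_min f z))"

definition mu_ratio :: "(complex \<Rightarrow> complex) \<Rightarrow> ereal" where
  "mu_ratio f = (if M_sup f = \<infinity> \<or> m_inf f = 0 then \<infinity> else M_sup f / m_inf f)"

definition harmonic_john_constant :: ereal where
  "harmonic_john_constant =
     (INF f\<in>nonconst_harmonic_maps - univalent_harmonic_maps. mu_ratio f)"

end

theory Submission
  imports Defs "HOL-Complex_Analysis.Complex_Analysis"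
begin

text \<open>
  \<^bold>\<open>Lower bound.\<close> A harmonic mapping of the disk is \<open>f = h + cnj g\<close> with \<open>h\<close>, \<open>g\<close>
  holomorphic, \<open>h' = f\<^sub>z\<close> and \<open>cnj g'\<close> equal to the other Wirtinger derivative. For every
  unimodular \<open>\<epsilon>\<close> the triangle inequality puts \<open>\<bar>h' + \<epsilon> g'\<bar>\<close> between \<open>\<lambda>\<^sub>f\<close> and \<open>\<Lambda>\<^sub>f\<close>, so all
  the holomorphic functions \<open>h + \<epsilon> g\<close> inherit the bounds of \<open>f\<close>. If they are all injective,
  so is \<open>f\<close>: an equality \<open>f x = f y\<close> says that \<open>h x - h y\<close> and \<open>g y - g x\<close> are complex conjugates,
  hence differ by a unimodular factor \<open>\<epsilon>\<close>, and \<open>h + \<epsilon> g\<close> takes the same value at \<open>x\<close> and \<open>y\<close>.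
  Thus the lower bound reduces to holomorphic functions \<open>F\<close> with \<open>m \<le> \<bar>F'\<bar> \<le> M\<close> and
  \<open>M < exp (pi / 2) * m\<close> (\<open>analytic_john_univalence\<close>).

  For such \<open>F\<close> the values of \<open>log F'\<close> lie in a vertical strip of width less than \<open>pi / 2\<close>, and the
  Schwarz--Pick inequality for strips yields \<open>(1 - \<bar>z\<bar>\<^sup>2) \<bar>F'' / F'\<bar> \<le> k\<close> with some \<open>k < 1\<close>. Becker's
  criterion (\<open>becker_univalence\<close>) turns this into injectivity. The reason is that
  Becker's explicit quasiconformal extension \<open>F w + (z - w) F' w\<close>, with \<open>w\<close> the reflection of \<open>z\<close>
  in the unit circle, has dilatation at most \<open>k\<close>, is differentiable also on the circle, and is
  asymptotically linear at infinity. For such a map of the whole plane the set of points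
  that share their value with another point is open, closed and bounded, hence empty
  (\<open>quasiregular_asymptotically_linear_inj\<close>).

  \<^bold>\<open>Upper bound.\<close> For \<open>\<alpha> > 1\<close> the function \<open>(1 + z) powr (1 + \<i> \<alpha>)\<close> is holomorphic on the disk, the
  modulus of its derivative is \<open>exp (- \<alpha> Arg (1 + z))\<close> up to a constant factor, so its quotient
  \<open>\<mu>\<close> is at most \<open>exp (\<alpha> pi)\<close>. In the logarithmic coordinate \<open>Ln (1 + z)\<close> it is \<open>exp\<close> after
  a linear map, and \<open>\<alpha> > 1\<close> makes the period \<open>2 pi \<i> / (1 + \<i> \<alpha>)\<close> short enough in the vertical
  direction to fit into the strip that is the image of the half-plane; so it is not injective. Let
  \<open>\<alpha>\<close> tend to 1.
\<close>

section \<open>Injectivity of plane maps of bounded dilatation\<close>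

text \<open>
  A derivative \<open>v \<mapsto> a v + b cnj v\<close> has operator norm at most \<open>\<bar>a\<bar> + \<bar>b\<bar>\<close>. So the hypothesis makes
  \<open>F z - c z\<close> Lipschitz with a constant below \<open>\<bar>c\<bar>\<close>, too small to cancel the linear part.
\<close>

lemma inj_on_convex_near_linear:
  fixes F :: "complex \<Rightarrow> complex"
  assumes S: "convex S"
    and der: "\<And>z. z \<in> S \<Longrightarrow> (F has_derivative (\<lambda>v. a z * v + b z * cnj v)) (at z)"
    and near: "\<And>z. z \<in> S \<Longrightarrow> cmod (a z - c) + cmod (b z) \<le> K" "K < cmod c"
  shows "inj_on F S"
proof (rule inj_onI)
  fix x y assume xy: "x \<in> S" "y \<in> S" "F x = F y"
  define G where "G = (\<lambda>z. F z - c * z)"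
  have "cmod (G x - G y) \<le> K * cmod (x - y)"
  proof (rule differentiable_bound[OF S _ _ xy(1,2)])
    fix z assume z: "z \<in> S"
    show "(G has_derivative (\<lambda>v. (a z - c) * v + b z * cnj v)) (at z within S)"
      unfolding G_def
      by (rule has_derivative_eq_rhs, rule has_derivative_at_withinI)
         (auto intro!: derivative_eq_intros der z simp: algebra_simps)
    have "onorm (\<lambda>v. (a z - c) * v + b z * cnj v) \<le> cmod (a z - c) + cmod (b z)"
    proof (rule onorm_le)
      fix v
      have "cmod ((a z - c) * v + b z * cnj v) \<le> cmod ((a z - c) * v) + cmod (b z * cnj v)"
        by (rule norm_triangle_ineq)
      then show "cmod ((a z - c) * v + b z * cnj v) \<le> (cmod (a z - c) + cmod (b z)) * cmod v"
        by (simp add: norm_mult distrib_right)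
    qed
    then show "onorm (\<lambda>v. (a z - c) * v + b z * cnj v) \<le> K"
      using near(1)[OF z] by linarith
  qed
  moreover have "G x - G y = - (c * (x - y))"
    using xy by (simp add: G_def algebra_simps)
  ultimately have "cmod c * cmod (x - y) \<le> K * cmod (x - y)"
    by (simp add: norm_mult)
  then show "x = y"
    using near(2) by (auto simp: mult_le_cancel_right)
qed

text \<open>
  A dilatation \<open>\<bar>b\<bar> / \<bar>a\<bar>\<close> bounded by \<open>k < 1\<close> leaves enough room for \<open>b\<close> once \<open>a\<close> varies little. This gives injectivity near a finite point (\<open>c\<close> the value of \<open>a\<close> there) as
  well as near infinity (\<open>c\<close> the limit of \<open>a\<close>).
\<close>

lemma inj_on_convex_dilatation:
  fixes F :: "complex \<Rightarrow> complex"
  assumes S: "convex S"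
    and der: "\<And>z. z \<in> S \<Longrightarrow> (F has_derivative (\<lambda>v. a z * v + b z * cnj v)) (at z)"
    and dil: "\<And>z. z \<in> S \<Longrightarrow> cmod (b z) \<le> k * cmod (a z)" and k: "0 \<le> k" "k < 1"
    and near: "\<And>z. z \<in> S \<Longrightarrow> cmod (a z - c) \<le> (1 - k) / 4 * cmod c" and c: "c \<noteq> 0"
  shows "inj_on F S"
proof (rule inj_on_convex_near_linear[OF S der])
  fix z assume z: "z \<in> S"
  have "cmod (a z) \<le> cmod (a z - c) + cmod c"
    by (metis diff_add_cancel norm_triangle_ineq)
  then have "cmod (b z) \<le> k * cmod (a z - c) + k * cmod c"
    using dil[OF z] k by (smt (verit) distrib_left mult_left_mono)
  also have "\<dots> \<le> cmod (a z - c) + k * cmod c"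
    using k by (simp add: mult_left_le_one_le)
  finally show "cmod (a z - c) + cmod (b z) \<le> (1 + k) / 2 * cmod c"
    using near[OF z] by (simp add: field_simps)
next
  show "(1 + k) / 2 * cmod c < cmod c"
    using k c by (simp add: field_simps)
qed

text \<open>
  The set \<open>P\<close> of points where \<open>F\<close> repeats a value is open because \<open>F\<close> is an open map near the second
  preimage, and closed because fibers have bounded diameter and two preimages cannot merge
  at a point of local injectivity. Far out it is empty, since a whole fiber lies in a disk on which
  \<open>a\<close> is close to its limit. As the plane is connected, \<open>P\<close> is empty.
\<close>

lemma quasiregular_asymptotically_linear_inj:
  fixes F :: "complex \<Rightarrow> complex"
  assumes der: "\<And>z. (F has_derivative (\<lambda>v. a z * v + b z * cnj v)) (at z)"
    and a: "continuous_on UNIV a" "\<And>z. a z \<noteq> 0"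
    and dil: "\<And>z. cmod (b z) \<le> k * cmod (a z)" and k: "0 \<le> k" "k < 1"
    and lim: "(a \<longlongrightarrow> c) at_infinity" "c \<noteq> 0"
    and bdd: "\<And>z. cmod (F z - c * z) \<le> B"
  shows "inj F"
proof -
  have contF: "continuous_on S F" for S
    by (meson continuous_at_imp_continuous_on der has_derivative_continuous)
  have isF: "isCont F z" for z
    using der has_derivative_continuous by blast
  have loc: "\<exists>e>0. inj_on F (ball z e)" for z
  proof -
    have "0 < (1 - k) / 4 * cmod (a z)" using k a by simp
    then obtain e where e: "e > 0" "\<And>w. dist w z < e \<Longrightarrow> dist (a w) (a z) < (1 - k) / 4 * cmod (a z)"
      using a(1) unfolding continuous_on_iff by (metis UNIV_I)
    have "inj_on F (ball z e)"
      by (rule inj_on_convex_dilatation[where c = "a z", OF convex_ball der dil k])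
         (use e a in \<open>auto simp: dist_commute dist_norm intro: less_imp_le\<close>)
    then show ?thesis using e by blast
  qed
  define P where "P = {x. \<exists>y. y \<noteq> x \<and> F y = F x}"
  have fiber: "cmod (x - y) \<le> 2 * B / cmod c" if "F x = F y" for x y
  proof -
    have "c * (x - y) = (F y - c * y) - (F x - c * x)"
      using that by (simp add: algebra_simps)
    then have "cmod c * cmod (x - y) \<le> 2 * B"
      using bdd[of x] bdd[of y] by (metis norm_mult norm_triangle_ineq4 add_mono order_trans mult_2)
    then show ?thesis using lim(2) by (simp add: field_simps)
  qed
  have "open P"
    unfolding open_subopen[of P]
  proof
    fix x assume "x \<in> P"
    then obtain y where y: "y \<noteq> x" "F y = F x" by (auto simp: P_def)
    obtain e where e: "e > 0" "inj_on F (ball y e)" using loc by blast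
    \<comment> \<open>Half the distance keeps the neighbourhoods of the two preimages disjoint.\<close>
    define d where "d = min e (dist x y / 2)"
    have d: "d > 0" "inj_on F (ball y d)"
      using e y by (auto simp: d_def intro: inj_on_subset)
    have "open (F ` ball y d)"
      using invariance_of_domain contF d(2) open_ball by blast
    then have "open (F -` (F ` ball y d))"
      using contF[of UNIV] by (rule open_vimage)
    then have op: "open (F -` (F ` ball y d) \<inter> ball x d)" by blast
    have "F -` (F ` ball y d) \<inter> ball x d \<subseteq> P"
    proof
      fix u assume u: "u \<in> F -` (F ` ball y d) \<inter> ball x d"
      then obtain v where v: "dist y v < d" "F v = F u" by auto
      have "dist x u < d" using u by simp
      moreover have "d + d \<le> dist x y" by (simp add: d_def)
      ultimately have "v \<noteq> u"
        using v(1) dist_triangle[of x y u] by (metis dist_commute add_strict_mono not_less order_trans)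
      with v show "u \<in> P" by (auto simp: P_def)
    qed
    moreover have "x \<in> F -` (F ` ball y d) \<inter> ball x d"
      using d(1) y by (metis IntI centre_in_ball imageI vimageI)
    ultimately show "\<exists>T. open T \<and> x \<in> T \<and> T \<subseteq> P" using op by blast
  qed
  moreover have "closed P"
    unfolding closed_sequential_limits
  proof (intro allI impI, elim conjE)
    fix X x assume X: "\<forall>n::nat. X n \<in> P" "X \<longlonglongrightarrow> x"
    then obtain Y where Y: "\<And>n. Y n \<noteq> X n" "\<And>n. F (Y n) = F (X n)"
      unfolding P_def by simp metis
    have "bounded (range X)" using X(2) by (rule convergent_imp_bounded)
    then obtain R where R: "\<And>n. cmod (X n) \<le> R" by (auto simp: bounded_iff)
    have "cmod (Y n) \<le> R + 2 * B / cmod c" for n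
      using R[of n] fiber[OF Y(2)[of n]] norm_triangle_sub[of "Y n" "X n"] by linarith
    then have "bounded (range Y)" by (auto simp: bounded_iff)
    then obtain y r where r: "strict_mono r" "(Y \<circ> r) \<longlonglongrightarrow> y"
      using bounded_imp_convergent_subsequence by blast
    have Xr: "(X \<circ> r) \<longlonglongrightarrow> x" using X(2) r(1) LIMSEQ_subseq_LIMSEQ by blast
    have "(\<lambda>n. F ((Y \<circ> r) n)) \<longlonglongrightarrow> F y" "(\<lambda>n. F ((X \<circ> r) n)) \<longlonglongrightarrow> F x"
      using isF r(2) Xr isCont_tendsto_compose by blast+
    then have Fxy: "F y = F x" using Y(2) by (simp add: LIMSEQ_unique)
    have "y \<noteq> x"
    proof
      assume "y = x"
      obtain e where e: "e > 0" "inj_on F (ball x e)" using loc by blast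
      have "eventually (\<lambda>n. dist ((X \<circ> r) n) x < e \<and> dist ((Y \<circ> r) n) x < e) sequentially"
        using tendstoD[OF Xr e(1)] tendstoD[OF r(2)[unfolded \<open>y = x\<close>] e(1)] by (rule eventually_conj)
      then obtain n where "dist ((X \<circ> r) n) x < e" "dist ((Y \<circ> r) n) x < e"
        unfolding eventually_sequentially by blast
      then have "X (r n) \<in> ball x e" "Y (r n) \<in> ball x e" by (auto simp: dist_commute)
      then show False using e(2) Y by (metis inj_onD)
    qed
    with Fxy show "x \<in> P" by (auto simp: P_def)
  qed
  moreover have "P \<noteq> UNIV"
  proof -
    have "0 < (1 - k) / 4 * cmod c" using k lim by simp
    from tendstoD[OF lim(1) this] obtain R where
      R: "\<And>z. cmod z \<ge> R \<Longrightarrow> dist (a z) c < (1 - k) / 4 * cmod c"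
      unfolding eventually_at_infinity by blast
    \<comment> \<open>A point so far out that the disk containing its whole fiber avoids \<open>ball 0 R\<close>.\<close>
    define x where "x = complex_of_real (\<bar>R\<bar> + 2 * B / cmod c)"
    have B: "B \<ge> 0" using bdd[of 0] norm_ge_zero order_trans by blast
    have nx: "cmod x = \<bar>R\<bar> + 2 * B / cmod c"
      unfolding x_def norm_of_real using B by (simp add: lim)
    have "inj_on F (cball x (2 * B / cmod c))"
    proof (rule inj_on_convex_dilatation[where c = c, OF convex_cball der dil k _ lim(2)])
      fix z assume "z \<in> cball x (2 * B / cmod c)"
      then have "cmod (x - z) \<le> 2 * B / cmod c" by (simp add: dist_norm)
      then have "R \<le> cmod z" using nx norm_triangle_sub[of x z] by linarith
      then show "cmod (a z - c) \<le> (1 - k) / 4 * cmod c" using R by (simp add: dist_norm less_imp_le)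
    qed
    moreover have "y \<in> cball x (2 * B / cmod c)" if "F y = F x" for y
      using fiber[of x y] that by (simp add: dist_norm)
    moreover have "x \<in> cball x (2 * B / cmod c)" using B by simp
    ultimately have "x \<notin> P" by (auto simp: P_def inj_on_def)
    then show ?thesis by blast
  qed
  ultimately have "P = {}" by (metis clopen)
  then show ?thesis by (auto simp: P_def inj_on_def)
qed

section \<open>Becker's extension and univalence criterion\<close>

lemma has_derivative_complex_reflection:
  assumes "z \<noteq> 0"
  shows "((\<lambda>z. inverse (cnj z)) has_derivative (\<lambda>v. - (inverse (cnj z))\<^sup>2 * cnj v)) (at z)"
  using assms
  by (auto intro!: derivative_eq_intros bounded_linear.has_derivative[OF bounded_linear_cnj]
           simp: power2_eq_square fun_eq_iff)

text \<open>
  Outside the closed disk put \<open>F z = f w + (z - w) f' w\<close> with \<open>w = 1 / cnj z\<close>. Then \<open>F\<^sub>z = f' w\<close>, and the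
  derivative with respect to \<open>cnj z\<close> is \<open>- w\<^sup>2 (z - w) f'' w\<close>, whose modulus is exactly
  \<open>(1 - \<bar>w\<bar>\<^sup>2) \<bar>w f'' w\<bar>\<close>: the hypothesis bounds the dilatation of the extension. On the circle \<open>z = w\<close>, so
  both pieces have the same derivative. Holomorphy beyond the closed disk makes \<open>F - f' 0 * z\<close>
  bounded.
\<close>

lemma becker_extension_inj:
  assumes hol: "f holomorphic_on ball 0 R" and R: "1 < R"
    and nz: "\<And>z. cmod z \<le> 1 \<Longrightarrow> deriv f z \<noteq> 0"
    and beck: "\<And>z. cmod z < 1 \<Longrightarrow> (1 - (cmod z)\<^sup>2) * cmod (z * deriv (deriv f) z) \<le> k * cmod (deriv f z)"
    and k: "0 \<le> k" "k < 1"
  shows "inj_on f (cball 0 1)"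
proof -
  \<comment> \<open>The coefficients of the derivative of \<open>F\<close>: \<open>a\<close> is \<open>f'\<close> at the reflected point \<open>\<rho> z\<close>, which gives
    the continuity of \<open>a\<close> across the circle and its limit at infinity.\<close>
  define \<rho> where "\<rho> = (\<lambda>z::complex. if z \<in> cball 0 1 then z else inverse (cnj z))"
  define a where "a = (\<lambda>z. deriv f (\<rho> z))"
  define b where "b = (\<lambda>z. if z \<in> cball 0 1 then 0
     else - (inverse (cnj z))\<^sup>2 * (z - inverse (cnj z)) * deriv (deriv f) (inverse (cnj z)))"
  define g where "g = (\<lambda>z. let w = inverse (cnj z) in f w + (z - w) * deriv f w)"
  define F where "F = (\<lambda>z. if z \<in> cball 0 1 then f z else g z)"
  have hol': "deriv f holomorphic_on ball 0 R" by (intro holomorphic_deriv hol open_ball)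
  have df: "(f has_field_derivative deriv f w) (at w)" if "cmod w < R" for w
    using holomorphic_derivI[OF hol open_ball] that by simp
  have ddf: "(deriv f has_field_derivative deriv (deriv f) w) (at w)" if "cmod w < R" for w
    using holomorphic_derivI[OF hol' open_ball] that by simp
  have sub: "cball 0 1 \<subseteq> ball (0::complex) R" using R by auto
  have refl_le: "cmod (inverse (cnj z)) \<le> 1" if "cmod z \<ge> 1" for z
    using that by (simp add: norm_inverse inverse_le_1_iff)
  have \<rho>_le: "cmod (\<rho> z) \<le> 1" for z
    unfolding \<rho>_def using refl_le[of z] by auto
  have circ: "inverse (cnj z) = z" if "cmod z = 1" for z
    by (rule inverse_unique) (use complex_norm_square[of z] that in \<open>simp add: mult.commute\<close>)
  have dg: "(g has_derivative (\<lambda>v. deriv f w * v + - w\<^sup>2 * (z - w) * deriv (deriv f) w * cnj v)) (at z)"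
    if z: "cmod z \<ge> 1" and w: "w = inverse (cnj z)" for z w
  proof -
    have z0: "z \<noteq> 0" using z by auto
    have wR: "cmod w < R" using refl_le[OF z] R w by simp
    note inv = has_derivative_complex_reflection[OF z0, folded w]
    have 1: "((\<lambda>z. f (inverse (cnj z))) has_derivative (\<lambda>v. deriv f w * (- w\<^sup>2 * cnj v))) (at z)"
      by (rule has_derivative_compose[OF inv])
         (use df[OF wR] w in \<open>simp add: has_field_derivative_def\<close>)
    have 2: "((\<lambda>z. deriv f (inverse (cnj z))) has_derivative (\<lambda>v. deriv (deriv f) w * (- w\<^sup>2 * cnj v))) (at z)"
      by (rule has_derivative_compose[OF inv])
         (use ddf[OF wR] w in \<open>simp add: has_field_derivative_def\<close>)
    have "((\<lambda>z. f (inverse (cnj z)) + (z - inverse (cnj z)) * deriv f (inverse (cnj z))) has_derivative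
       (\<lambda>v. deriv f w * (- w\<^sup>2 * cnj v) + ((z - w) * (deriv (deriv f) w * (- w\<^sup>2 * cnj v)) + (v - (- w\<^sup>2 * cnj v)) * deriv f w))) (at z)"
      unfolding w
      by (intro has_derivative_add has_derivative_mult has_derivative_diff has_derivative_ident
            1[unfolded w] 2[unfolded w] inv[unfolded w])
    then show ?thesis
      unfolding g_def Let_def by (rule has_derivative_eq_rhs) (auto simp: fun_eq_iff algebra_simps)
  qed
  have der: "(F has_derivative (\<lambda>v. a z * v + b z * cnj v)) (at z)" for z
  proof -
    have cl: "closure (- cball 0 1) = - ball (0::complex) 1"
      by (simp add: closure_complement)
    let ?D = "\<lambda>z v. deriv f (inverse (cnj z)) * v + - (inverse (cnj z))\<^sup>2 * (z - inverse (cnj z)) * deriv (deriv f) (inverse (cnj z)) * cnj v"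
    have "((\<lambda>z. if z \<in> cball 0 1 then f z else g z) has_derivative
        (if z \<in> cball 0 1 then (\<lambda>v. deriv f z * v) else ?D z)) (at z within (cball 0 1 \<union> - cball 0 1))"
    proof (rule has_derivative_If_within_closures)
      assume "z \<in> cball 0 1 \<union> closure (cball 0 1) \<inter> closure (- cball 0 1)"
      then have "cmod z \<le> 1" by auto
      then have "cmod z < R" using R by linarith
      then show "(f has_derivative (*) (deriv f z)) (at z within cball 0 1 \<union> closure (cball 0 1) \<inter> closure (- cball 0 1))"
        by (rule has_derivative_at_withinI[OF df[unfolded has_field_derivative_def]])
    next
      assume "z \<in> - cball 0 1 \<union> closure (cball 0 1) \<inter> closure (- cball 0 1)"
      then have "cmod z \<ge> 1" by (auto simp: cl)
      then show "(g has_derivative ?D z) (at z within - cball 0 1 \<union> closure (cball 0 1) \<inter> closure (- cball 0 1))"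
        by (rule has_derivative_at_withinI[OF dg[OF _ refl]])
    next
      assume "z \<in> closure (cball 0 1)" "z \<in> closure (- cball 0 1)"
      then have "inverse (cnj z) = z" by (intro circ) (auto simp: cl)
      then show "f z = g z" "(*) (deriv f z) = ?D z" by (auto simp: g_def Let_def fun_eq_iff)
    qed auto
    then show ?thesis
      unfolding F_def a_def b_def \<rho>_def by (cases "z \<in> cball 0 1") (simp_all add: Compl_partition)
  qed
  have "continuous_on (cball 0 1 \<union> - ball 0 1) \<rho>"
    unfolding \<rho>_def
    by (rule continuous_on_If) (auto intro!: continuous_intros simp: circ)
  moreover have "cball 0 1 \<union> - ball 0 1 = (UNIV :: complex set)" by auto
  ultimately have cont\<rho>: "continuous_on UNIV \<rho>" by simp
  have conta: "continuous_on UNIV a"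
    unfolding a_def
    by (rule continuous_on_compose2[OF holomorphic_on_imp_continuous_on[OF hol'] cont\<rho>])
       (auto intro: le_less_trans[OF \<rho>_le R])
  have dil: "cmod (b z) \<le> k * cmod (a z)" for z
  proof (cases "z \<in> cball 0 1")
    case True
    then show ?thesis using k by (simp add: b_def)
  next
    case False
    define w where "w = inverse (cnj z)"
    have z: "cmod z > 1" using False by simp
    then have w: "cmod w < 1" "w \<noteq> 0" by (auto simp: w_def norm_inverse inverse_less_1_iff)
    have "cmod (w * (z - w)) = 1 - (cmod w)\<^sup>2"
    proof -
      have "z \<noteq> 0" using z by auto
      then have "cnj w * z = 1" by (simp add: w_def)
      then have "cnj w * (z - w) = of_real (1 - (cmod w)\<^sup>2)"
        using complex_norm_square[of w] by (simp add: right_diff_distrib mult.commute)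
      then have "cmod (cnj w * (z - w)) = \<bar>1 - (cmod w)\<^sup>2\<bar>" by (metis norm_of_real)
      moreover have "(cmod w)\<^sup>2 \<le> 1" using w by (simp add: power_le_one less_imp_le)
      ultimately show ?thesis by (simp add: norm_mult)
    qed
    then have "cmod (b z) = (1 - (cmod w)\<^sup>2) * cmod (w * deriv (deriv f) w)"
      using False unfolding b_def w_def[symmetric]
      by (simp add: norm_mult power2_eq_square)
    also have "\<dots> \<le> k * cmod (deriv f w)" by (rule beck[OF w(1)])
    finally show ?thesis using False by (simp add: a_def \<rho>_def w_def)
  qed
  have "((\<lambda>z. inverse (cnj z)) \<longlongrightarrow> 0) at_infinity"
    using tendsto_cnj[OF tendsto_inverse_0] by simp
  moreover have "eventually (\<lambda>z::complex. inverse (cnj z) = \<rho> z) at_infinity"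
    unfolding eventually_at_infinity by (rule exI[of _ 2]) (auto simp: \<rho>_def)
  ultimately have lim\<rho>: "(\<rho> \<longlongrightarrow> 0) at_infinity" by (rule Lim_transform_eventually)
  have "isCont (deriv f) 0" using ddf[of 0] R DERIV_isCont by auto
  then have lima: "(a \<longlongrightarrow> deriv f 0) at_infinity"
    unfolding a_def by (rule isCont_tendsto_compose[OF _ lim\<rho>])
  have cpt: "compact (cball (0::complex) 1)" by simp
  have bd: "\<exists>B. \<forall>z. cmod z \<le> 1 \<longrightarrow> cmod (h z) \<le> B" if "h holomorphic_on ball 0 R" for h
    using compact_imp_bounded[OF compact_continuous_image[OF _ cpt]]
      continuous_on_subset[OF holomorphic_on_imp_continuous_on[OF that] sub]
    by (fastforce simp: bounded_iff)
  obtain B0 B1 B2 where B: "\<And>z. cmod z \<le> 1 \<Longrightarrow> cmod (f z) \<le> B0" "\<And>z. cmod z \<le> 1 \<Longrightarrow> cmod (deriv f z) \<le> B1"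
     "\<And>z. cmod z \<le> 1 \<Longrightarrow> cmod (deriv (deriv f) z) \<le> B2"
    using bd[OF hol] bd[OF hol'] bd[OF holomorphic_deriv[OF hol' open_ball]] by metis
  have B1: "B1 \<ge> 0" and B2: "B2 \<ge> 0" using order_trans[OF norm_ge_zero B(2)[of 0]] order_trans[OF norm_ge_zero B(3)[of 0]] by simp_all
  have lip: "cmod (deriv f w - deriv f 0) \<le> B2 * cmod w" if "cmod w \<le> 1" for w
  proof -
    have "(deriv f has_field_derivative deriv (deriv f) z) (at z within cball 0 1)" if "cmod z \<le> 1" for z
      by (rule has_field_derivative_at_within, rule ddf) (use that R in simp)
    then show ?thesis
      using field_differentiable_bound[of "cball 0 1" "deriv f" "deriv (deriv f)" B2 w 0] that B(3) by auto
  qed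
  have bdd: "cmod (F z - deriv f 0 * z) \<le> B0 + B1 + B2" for z
  proof (cases "z \<in> cball 0 1")
    case True
    then have "cmod z \<le> 1" by simp
    moreover from this have "cmod (deriv f 0 * z) \<le> B1 * 1"
      unfolding norm_mult using B(2)[of 0] B1 by (intro mult_mono) auto
    ultimately show ?thesis
      using True B2 B(1)[of z] norm_triangle_ineq4[of "f z" "deriv f 0 * z"] by (simp add: F_def)
  next
    case False
    define w where "w = inverse (cnj z)"
    have z: "cmod z > 1" using False by simp
    then have w: "cmod w \<le> 1" using refl_le by (auto simp: w_def)
    have eq: "F z - deriv f 0 * z = (f w - w * deriv f w) + z * (deriv f w - deriv f 0)"
      using False by (simp add: F_def g_def Let_def w_def algebra_simps)
    have "cmod (w * deriv f w) \<le> 1 * B1"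
      unfolding norm_mult using w B(2) by (intro mult_mono) auto
    moreover have "cmod (z * (deriv f w - deriv f 0)) \<le> B2"
    proof -
      have "cmod z * cmod w = 1"
        unfolding w_def norm_inverse complex_mod_cnj by (rule right_inverse) (use z in auto)
      then have "cmod z * (B2 * cmod w) = B2" by (simp add: mult.left_commute)
      moreover have "cmod z * cmod (deriv f w - deriv f 0) \<le> cmod z * (B2 * cmod w)"
        using lip[OF w] by (intro mult_left_mono) auto
      ultimately show ?thesis by (simp only: norm_mult)
    qed
    ultimately show ?thesis
      unfolding eq using B(1)[OF w] norm_triangle_ineq4[of "f w" "w * deriv f w"]
        norm_triangle_ineq[of "f w - w * deriv f w" "z * (deriv f w - deriv f 0)"] by linarith
  qed
  have "inj F"
    by (rule quasiregular_asymptotically_linear_inj[OF der conta _ dil k lima _ bdd])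
       (use nz \<rho>_le in \<open>auto simp: a_def\<close>)
  then have "inj_on F (cball 0 1)" by (rule inj_on_subset) simp
  then show ?thesis by (rule inj_on_cong[THEN iffD1, rotated]) (simp add: F_def)
qed

text \<open>
  The extension requires \<open>f\<close> to be holomorphic beyond the closed disk, which holds for the dilations
  \<open>f (r z)\<close>; the criterion passes to them because \<open>1 - \<bar>z\<bar>\<^sup>2 \<le> 1 - \<bar>r z\<bar>\<^sup>2\<close>.
\<close>

lemma becker_univalence:
  assumes hol: "f holomorphic_on ball 0 1"
    and nz: "\<And>z. cmod z < 1 \<Longrightarrow> deriv f z \<noteq> 0"
    and beck: "\<And>z. cmod z < 1 \<Longrightarrow> (1 - (cmod z)\<^sup>2) * cmod (z * deriv (deriv f) z) \<le> k * cmod (deriv f z)"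
    and k: "0 \<le> k" "k < 1"
  shows "inj_on f (ball 0 1)"
proof (rule inj_onI)
  fix x y assume xy: "x \<in> ball 0 1" "y \<in> ball 0 1" "f x = f y"
  obtain r where r: "max (cmod x) (cmod y) < r" "r < 1"
    using dense[of "max (cmod x) (cmod y)" 1] xy by auto
  have r0: "r > 0" using r by (smt (verit) norm_ge_zero)
  define c where "c = complex_of_real r"
  have c: "cmod c = r" "c \<noteq> 0" using r0 by (auto simp: c_def)
  define h where "h = (\<lambda>z. f (c * z))"
  have scale: "cmod (c * z) < 1" if "z \<in> ball 0 (1 / r)" for z
    using that r0 by (simp add: norm_mult c field_simps)
  have hol': "deriv f holomorphic_on ball 0 1" by (intro holomorphic_deriv hol open_ball)
  have h1: "deriv h z = c * deriv f (c * z)" if "z \<in> ball 0 (1 / r)" for z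
  proof -
    have "(f has_field_derivative deriv f (c * z)) (at (c * z))"
      by (rule holomorphic_derivI[OF hol open_ball]) (use scale[OF that] in simp)
    from DERIV_chain2[OF this DERIV_cmult_Id] show ?thesis
      unfolding h_def by (simp add: DERIV_imp_deriv mult.commute)
  qed
  have h2: "deriv (deriv h) z = c * (c * deriv (deriv f) (c * z))" if "z \<in> ball 0 (1 / r)" for z
  proof -
    have "((\<lambda>z. c * deriv f (c * z)) has_field_derivative c * (c * deriv (deriv f) (c * z))) (at z)"
    proof -
      have "(deriv f has_field_derivative deriv (deriv f) (c * z)) (at (c * z))"
        by (rule holomorphic_derivI[OF hol' open_ball]) (use scale[OF that] in simp)
      from DERIV_cmult[OF DERIV_chain2[OF this DERIV_cmult_Id], of c] show ?thesis
        by (simp add: mult.commute)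
    qed
    then have "(deriv h has_field_derivative c * (c * deriv (deriv f) (c * z))) (at z)"
      by (rule has_field_derivative_transform_within_open[OF _ open_ball that]) (simp add: h1)
    then show ?thesis by (rule DERIV_imp_deriv)
  qed
  have r1: "1 < 1 / r" using r r0 by simp
  have "inj_on h (cball 0 1)"
  proof (rule becker_extension_inj[OF _ r1 _ _ k])
    show "h holomorphic_on ball 0 (1 / r)"
      unfolding h_def
      by (rule holomorphic_on_compose_gen[of "\<lambda>z. c * z" _ f, unfolded o_def, OF _ hol])
         (use scale in \<open>auto intro!: holomorphic_intros\<close>)
    show "deriv h z \<noteq> 0" if "cmod z \<le> 1" for z
      using that r1 h1 scale nz c by auto
    fix z assume z: "cmod z < 1"
    then have zr: "z \<in> ball 0 (1 / r)" using r1 by auto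
    have "(cmod (c * z))\<^sup>2 \<le> (cmod z)\<^sup>2"
      using r r0 by (intro power_mono) (auto simp: norm_mult c mult_left_le_one_le)
    then have "(1 - (cmod z)\<^sup>2) * cmod (z * deriv (deriv h) z) \<le>
       (1 - (cmod (c * z))\<^sup>2) * cmod (z * deriv (deriv h) z)"
      by (intro mult_right_mono) auto
    also have "\<dots> = r * ((1 - (cmod (c * z))\<^sup>2) * cmod (c * z * deriv (deriv f) (c * z)))"
      by (simp add: h2[OF zr] norm_mult c)
    also have "\<dots> \<le> r * (k * cmod (deriv f (c * z)))"
      using scale[OF zr] r0 by (intro mult_left_mono beck) auto
    finally show "(1 - (cmod z)\<^sup>2) * cmod (z * deriv (deriv h) z) \<le> k * cmod (deriv h z)"
      by (simp add: h1[OF zr] norm_mult c mult_ac)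
  qed
  moreover have "x / c \<in> cball 0 1" "y / c \<in> cball 0 1" "h (x / c) = h (y / c)"
    using r xy c by (auto simp: h_def norm_divide)
  ultimately have "x / c = y / c" by (metis inj_onD)
  then show "x = y" using c by simp
qed

section \<open>Schwarz--Pick inequalities for half-planes and strips\<close>

text \<open>
  The Cayley transform centred at \<open>E 0\<close> carries the right half-plane to the disk, so this is the
  Schwarz lemma.
\<close>

lemma half_plane_schwarz_pick_0:
  assumes hol: "E holomorphic_on ball 0 1" and pos: "\<And>z. cmod z < 1 \<Longrightarrow> Re (E z) > 0"
  shows "cmod (deriv E 0) \<le> 2 * Re (E 0)"
proof -
  define Q where "Q = (\<lambda>z. (E z - E 0) / (E z + cnj (E 0)))"
  have E0: "Re (E 0) > 0" using pos by simp
  have den: "E z + cnj (E 0) \<noteq> 0" if "cmod z < 1" for z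
    using pos[OF that] E0 by (auto simp: complex_eq_iff)
  have "Q holomorphic_on ball 0 1"
    unfolding Q_def using den by (auto intro!: holomorphic_intros hol)
  moreover have "Q 0 = 0" by (simp add: Q_def)
  moreover have "cmod (Q z) < 1" if "cmod z < 1" for z
  proof -
    have "\<bar>Re (E z) - Re (E 0)\<bar> < \<bar>Re (E z) + Re (E 0)\<bar>" using pos[OF that] E0 by linarith
    then have "(Re (E z) - Re (E 0))\<^sup>2 < (Re (E z) + Re (E 0))\<^sup>2"
      by (rule power2_strict_mono)
    then have "cmod (E z - E 0) < cmod (E z + cnj (E 0))" by (simp add: cmod_def)
    then show ?thesis using den[OF that] by (simp add: Q_def norm_divide)
  qed
  ultimately have "cmod (deriv Q 0) \<le> 1" using Schwarz_Lemma(2)[of Q 0] by auto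
  moreover have "deriv Q 0 = deriv E 0 / of_real (2 * Re (E 0))"
  proof -
    have "(E has_field_derivative deriv E 0) (at 0)"
      by (rule holomorphic_derivI[OF hol open_ball]) simp
    then have "(Q has_field_derivative deriv E 0 * (E 0 + cnj (E 0)) / ((E 0 + cnj (E 0)) * (E 0 + cnj (E 0)))) (at 0)"
      unfolding Q_def using den[of 0] by (auto intro!: derivative_eq_intros)
    then have "deriv Q 0 = deriv E 0 / (E 0 + cnj (E 0))"
      using den[of 0] by (auto dest!: DERIV_imp_deriv)
    then show ?thesis by (simp add: complex_add_cnj)
  qed
  ultimately show ?thesis using E0 by (simp add: norm_divide norm_mult field_simps)
qed

lemma half_plane_schwarz_pick:
  assumes hol: "E holomorphic_on ball 0 1" and pos: "\<And>z. cmod z < 1 \<Longrightarrow> Re (E z) > 0"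
    and z: "cmod z < 1"
  shows "(1 - (cmod z)\<^sup>2) * cmod (deriv E z) \<le> 2 * Re (E z)"
proof -
  \<comment> \<open>The automorphism of the disk that sends 0 to \<open>z\<close>; its derivative at 0 is \<open>1 - \<bar>z\<bar>\<^sup>2\<close>.\<close>
  define m where "m = (\<lambda>w. Moebius_function 0 (- z) w)"
  have m0: "m 0 = z" and m1: "cmod (m w) < 1" if "cmod w < 1" for w
    using that z Moebius_function_norm_lt_1[of "-z" w 0] by (auto simp: m_def Moebius_function_simple)
  have "m holomorphic_on ball 0 1"
    unfolding m_def by (rule Moebius_function_holomorphic) (use z in simp)
  then have "(\<lambda>w. E (m w)) holomorphic_on ball 0 1"
    by (rule holomorphic_on_compose_gen[of m _ E, unfolded o_def, OF _ hol]) (auto simp: m1)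
  then have "cmod (deriv (\<lambda>w. E (m w)) 0) \<le> 2 * Re (E (m 0))"
    by (rule half_plane_schwarz_pick_0) (simp add: pos m1)
  moreover have "deriv (\<lambda>w. E (m w)) 0 = deriv E z * of_real (1 - (cmod z)\<^sup>2)"
  proof -
    have "(m has_field_derivative 1 - z * cnj z) (at 0)"
      unfolding m_def Moebius_function_simple by (auto intro!: derivative_eq_intros simp: algebra_simps)
    moreover have "(E has_field_derivative deriv E z) (at (m 0))"
      unfolding m0[of 0, simplified] by (rule holomorphic_derivI[OF hol open_ball]) (use z in simp)
    ultimately show ?thesis
      using DERIV_imp_deriv[OF DERIV_chain2[of E _ m]] complex_norm_square[of z] by simp
  qed
  ultimately show ?thesis
    using z m0[of 0] by (simp add: norm_mult abs_square_le_1 mult.commute del: of_real_diff of_real_power)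
qed

text \<open>
  The exponential \<open>E\<close> maps the strip to the right half-plane. There \<open>\<bar>E'\<bar>\<close> is \<open>(pi / L) \<bar>g'\<bar> \<bar>E\<bar>\<close>, and
  \<open>Re E \<le> \<bar>E\<bar>\<close> cancels the last factor.
\<close>

lemma strip_schwarz_pick:
  assumes hol: "g holomorphic_on ball 0 1"
    and strip: "\<And>z. cmod z < 1 \<Longrightarrow> \<bar>Re (g z) - c\<bar> < L / 2" and z: "cmod z < 1"
  shows "(1 - (cmod z)\<^sup>2) * cmod (deriv g z) \<le> 2 * L / pi"
proof -
  have L: "L > 0" using strip[OF z] by linarith
  define E where "E = (\<lambda>z. exp (\<i> * of_real (pi / L) * (g z - of_real c)))"
  have holE: "E holomorphic_on ball 0 1" unfolding E_def by (intro holomorphic_intros hol)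
  have pos: "Re (E w) > 0" if "cmod w < 1" for w
  proof -
    have "\<bar>pi / L * (Re (g w) - c)\<bar> < pi / 2"
    proof -
      have "pi / L * \<bar>Re (g w) - c\<bar> < pi / L * (L / 2)"
        using strip[OF that] L by (intro mult_strict_left_mono) auto
      then show ?thesis using L by (simp add: abs_mult)
    qed
    then have "cos (pi / L * (Re (g w) - c)) > 0" by (intro cos_gt_zero_pi) linarith+
    then show ?thesis by (simp add: E_def Re_exp)
  qed
  have "(g has_field_derivative deriv g z) (at z)"
    by (rule holomorphic_derivI[OF hol open_ball]) (use z in simp)
  then have "(E has_field_derivative \<i> * of_real (pi / L) * deriv g z * E z) (at z)"
    unfolding E_def using L by (auto intro!: derivative_eq_intros)
  then have "cmod (deriv E z) = pi / L * cmod (deriv g z) * cmod (E z)"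
    using L by (simp add: DERIV_imp_deriv norm_mult norm_divide)
  then have "(1 - (cmod z)\<^sup>2) * (pi / L * cmod (deriv g z) * cmod (E z)) \<le> 2 * Re (E z)"
    using half_plane_schwarz_pick[OF holE pos z] by simp
  also have "\<dots> \<le> 2 * cmod (E z)" using complex_Re_le_cmod by simp
  finally have "((1 - (cmod z)\<^sup>2) * (pi / L * cmod (deriv g z))) * cmod (E z) \<le> 2 * cmod (E z)"
    by (simp only: mult.assoc)
  moreover have "cmod (E z) > 0" by (simp add: E_def)
  ultimately have "(1 - (cmod z)\<^sup>2) * (pi / L * cmod (deriv g z)) \<le> 2"
    using mult_right_le_imp_le by blast
  then show ?thesis using L by (simp add: field_simps)
qed


section \<open>John's theorem for holomorphic functions\<close>

text \<open>
  The real part of \<open>log f'\<close> ranges over an interval of length \<open>ln (M / m) < pi / 2\<close>, and \<open>f'' / f'\<close> is the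
  derivative of \<open>log f'\<close>. The Schwarz--Pick inequality for the strip gives Becker's
  criterion with \<open>k = 2 L / pi < 1\<close>, where \<open>L\<close> is slightly larger than \<open>ln (M / m)\<close>: the values
  then lie in the open strip of width \<open>L\<close>, even when \<open>m = M\<close>.
\<close>

lemma analytic_john_univalence:
  assumes hol: "f holomorphic_on ball 0 1"
    and bounds: "\<And>z. cmod z < 1 \<Longrightarrow> m \<le> cmod (deriv f z) \<and> cmod (deriv f z) \<le> M"
    and m: "0 < m" and ratio: "M < exp (pi / 2) * m"
  shows "inj_on f (ball 0 1)"
proof -
  have hol': "deriv f holomorphic_on ball 0 1" by (intro holomorphic_deriv hol open_ball)
  have nz: "deriv f z \<noteq> 0" if "cmod z < 1" for z using bounds[OF that] m by auto
  obtain g where g: "g holomorphic_on ball 0 1" "\<And>z. z \<in> ball 0 1 \<Longrightarrow> deriv f z = exp (g z)"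
    using contractible_imp_holomorphic_log[OF hol' convex_imp_contractible[OF convex_ball]] nz by auto
  have Re_g: "Re (g z) = ln (cmod (deriv f z))" if "cmod z < 1" for z
    using g(2)[of z] that by simp
  have M: "M > 0" using bounds[of 0] m by auto
  have "ln M < pi / 2 + ln m"
    using ratio m M by (metis exp_gt_zero ln_exp ln_less_cancel_iff ln_mult_pos mult_pos_pos)
  then obtain L where L: "ln M - ln m < L" "L < pi / 2" using dense[of "ln M - ln m" "pi/2"] by auto
  have L0: "0 < L" using bounds[of 0] m M L(1) by (smt (verit) ln_le_cancel_iff norm_zero)
  have strip: "\<bar>Re (g z) - (ln m + ln M) / 2\<bar> < L / 2" if "cmod z < 1" for z
  proof -
    have "ln m \<le> Re (g z)" "Re (g z) \<le> ln M"
      using bounds[OF that] m M unfolding Re_g[OF that] by (auto simp: nz[OF that])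
    then show ?thesis using L(1) by (simp add: abs_if field_simps)
  qed
  show ?thesis
  proof (rule becker_univalence[OF hol nz])
    fix z :: complex assume z: "cmod z < 1"
    have "(g has_field_derivative deriv g z) (at z)"
      by (rule holomorphic_derivI[OF g(1) open_ball]) (use z in simp)
    then have "((\<lambda>z. exp (g z)) has_field_derivative exp (g z) * deriv g z) (at z)"
      by (auto intro!: derivative_eq_intros)
    then have "(deriv f has_field_derivative deriv f z * deriv g z) (at z)"
      using g(2) z by (auto intro: has_field_derivative_transform_within_open[where S = "ball 0 1"])
    then have ddf: "deriv (deriv f) z = deriv f z * deriv g z" by (rule DERIV_imp_deriv)
    have "(1 - (cmod z)\<^sup>2) * cmod (z * deriv g z) \<le> (1 - (cmod z)\<^sup>2) * cmod (deriv g z)"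
      using z by (intro mult_left_mono) (auto simp: norm_mult mult_left_le_one_le abs_square_le_1)
    also have "\<dots> \<le> 2 * L / pi" by (rule strip_schwarz_pick[OF g(1) strip z])
    finally show "(1 - (cmod z)\<^sup>2) * cmod (z * deriv (deriv f) z) \<le> 2 * L / pi * cmod (deriv f z)"
      using mult_right_mono[of _ _ "cmod (deriv f z)"] by (fastforce simp: ddf norm_mult mult_ac)
  qed (use L L0 in \<open>auto simp: field_simps\<close>)
qed

section \<open>Harmonic mappings as sums of holomorphic and antiholomorphic functions\<close>

lemma increment_near_linear:
  fixes \<phi> :: "real \<Rightarrow> 'b::real_normed_vector"
  assumes der: "\<And>v. v \<in> {0..t} \<Longrightarrow> (\<phi> has_vector_derivative \<phi>' v) (at v)"
    and B: "\<And>v. v \<in> {0..t} \<Longrightarrow> norm (\<phi>' v - c) \<le> B" and t: "0 \<le> t"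
  shows "norm (\<phi> t - \<phi> 0 - t *\<^sub>R c) \<le> B * t"
proof -
  have "norm ((\<phi> t - t *\<^sub>R c) - (\<phi> 0 - 0 *\<^sub>R c)) \<le> B * norm (t - 0)"
  proof (rule differentiable_bound[of "{0..t}" _ "\<lambda>v h. h *\<^sub>R (\<phi>' v - c)"])
    fix v assume v: "v \<in> {0..t}"
    have "((\<lambda>v. \<phi> v - v *\<^sub>R c) has_vector_derivative (\<phi>' v - c)) (at v)"
      by (rule derivative_eq_intros der v | simp)+
    then show "((\<lambda>v. \<phi> v - v *\<^sub>R c) has_derivative (\<lambda>h. h *\<^sub>R (\<phi>' v - c))) (at v within {0..t})"
      unfolding has_vector_derivative_def by (rule has_derivative_at_withinI)
    show "onorm (\<lambda>h. h *\<^sub>R (\<phi>' v - c)) \<le> B"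
      by (rule onorm_le) (use B[OF v] in \<open>simp add: mult.commute[of B] mult_left_mono\<close>)
  qed (use t in auto)
  then show ?thesis using t by (simp add: algebra_simps)
qed

text \<open>
  The second difference is symmetric in \<open>a\<close> and \<open>b\<close>, whereas its limit is the mixed derivative taken
  first along \<open>a\<close>, then along \<open>b\<close>. Exchanging \<open>a\<close> and \<open>b\<close> therefore identifies the two mixed
  derivatives.
\<close>

lemma second_difference_quotient_tendsto:
  fixes f D E :: "'a::real_normed_vector \<Rightarrow> 'b::real_normed_vector"
  assumes S: "open S" "p \<in> S"
    and a: "\<And>x t. x + t *\<^sub>R a \<in> S \<Longrightarrow> ((\<lambda>t. f (x + t *\<^sub>R a)) has_vector_derivative D (x + t *\<^sub>R a)) (at t)"
    and b: "\<And>x t. x + t *\<^sub>R b \<in> S \<Longrightarrow> ((\<lambda>t. D (x + t *\<^sub>R b)) has_vector_derivative E (x + t *\<^sub>R b)) (at t)"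
    and cont: "isCont E p"
  shows "((\<lambda>t. (f (p + t *\<^sub>R a + t *\<^sub>R b) - f (p + t *\<^sub>R a) - f (p + t *\<^sub>R b) + f p) /\<^sub>R t\<^sup>2) \<longlongrightarrow> E p) (at_right 0)"
proof (rule tendstoI)
  fix e :: real assume e: "e > 0"
  obtain r where r: "r > 0" "ball p r \<subseteq> S" using S open_contains_ball by blast
  obtain s where s: "s > 0" "\<And>y. dist y p < s \<Longrightarrow> dist (E y) (E p) < e / 2"
    using cont e unfolding continuous_at_eps_delta by (meson half_gt_zero)
  define d where "d = min r s / (norm a + norm b + 1)"
  have nab: "norm a + norm b + 1 > 0" by (smt (verit) norm_ge_zero)
  have d: "d > 0" using r s nab by (simp add: d_def)
  have near: "dist (p + u *\<^sub>R a + v *\<^sub>R b) p < min r s" if "0 \<le> u" "u < d" "0 \<le> v" "v < d" for u v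
  proof -
    have "norm (u *\<^sub>R a + v *\<^sub>R b) \<le> u * norm a + v * norm b"
      using norm_triangle_ineq[of "u *\<^sub>R a" "v *\<^sub>R b"] that by simp
    also have "\<dots> \<le> d * norm a + d * norm b"
      using that by (intro add_mono mult_right_mono) auto
    also have "\<dots> < d * (norm a + norm b + 1)" using d by (simp add: algebra_simps)
    also have "\<dots> = min r s" using nab by (simp add: d_def)
    finally show ?thesis by (simp add: dist_norm algebra_simps)
  qed
  have inS: "p + u *\<^sub>R a + v *\<^sub>R b \<in> S" if "0 \<le> u" "u < d" "0 \<le> v" "v < d" for u v
    using near[OF that] r by (auto simp: dist_commute)
  have "dist ((f (p + t *\<^sub>R a + t *\<^sub>R b) - f (p + t *\<^sub>R a) - f (p + t *\<^sub>R b) + f p) /\<^sub>R t\<^sup>2) (E p) < e"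
    if t: "0 < t" "t < d" for t
  proof -
    \<comment> \<open>The mean value estimate along \<open>b\<close> for \<open>D\<close>; its result is the bound for the derivative along \<open>a\<close>
      in the next estimate.\<close>
    have inner: "norm (D (p + u *\<^sub>R a + t *\<^sub>R b) - D (p + u *\<^sub>R a + 0 *\<^sub>R b) - t *\<^sub>R E p) \<le> (e / 2) * t"
      if u: "u \<in> {0..t}" for u
    proof (rule increment_near_linear)
      fix v assume v: "v \<in> {0..t}"
      show "((\<lambda>v. D (p + u *\<^sub>R a + v *\<^sub>R b)) has_vector_derivative E (p + u *\<^sub>R a + v *\<^sub>R b)) (at v)"
        by (rule b, rule inS) (use u v t in auto)
      show "norm (E (p + u *\<^sub>R a + v *\<^sub>R b) - E p) \<le> e / 2"
        using s(2)[of "p + u *\<^sub>R a + v *\<^sub>R b"] near[of u v] u v t by (simp add: dist_norm less_imp_le)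
    qed (use t in simp)
    let ?\<phi> = "\<lambda>u. f (p + t *\<^sub>R b + u *\<^sub>R a) - f (p + u *\<^sub>R a)"
    have "norm (?\<phi> t - ?\<phi> 0 - t *\<^sub>R (t *\<^sub>R E p)) \<le> (e / 2 * t) * t"
    proof (rule increment_near_linear)
      fix u assume u: "u \<in> {0..t}"
      have "p + t *\<^sub>R b + u *\<^sub>R a \<in> S" "p + u *\<^sub>R a \<in> S"
        using inS[of u t] inS[of u 0] u t by (auto simp: add_ac)
      then show "(?\<phi> has_vector_derivative (D (p + t *\<^sub>R b + u *\<^sub>R a) - D (p + u *\<^sub>R a))) (at u)"
        by (intro has_vector_derivative_diff a)
      show "norm (D (p + t *\<^sub>R b + u *\<^sub>R a) - D (p + u *\<^sub>R a) - t *\<^sub>R E p) \<le> e / 2 * t"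
        using inner[OF u] by (simp add: add_ac)
    qed (use t in simp)
    then have n: "norm (f (p + t *\<^sub>R a + t *\<^sub>R b) - f (p + t *\<^sub>R a) - f (p + t *\<^sub>R b) + f p - t\<^sup>2 *\<^sub>R E p) \<le> e / 2 * t\<^sup>2"
      (is "norm (?\<Delta> - _) \<le> _") by (simp add: algebra_simps power2_eq_square)
    have "?\<Delta> /\<^sub>R t\<^sup>2 - E p = (?\<Delta> - t\<^sup>2 *\<^sub>R E p) /\<^sub>R t\<^sup>2"
      using t by (simp add: scaleR_diff_right)
    then have "norm (?\<Delta> /\<^sub>R t\<^sup>2 - E p) = norm (?\<Delta> - t\<^sup>2 *\<^sub>R E p) / t\<^sup>2"
      by (simp add: divide_inverse mult.commute)
    also have "\<dots> \<le> e / 2" using n t by (simp add: divide_le_eq)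
    finally show ?thesis using e by (simp add: dist_norm)
  qed
  then show "\<forall>\<^sub>F t in at_right 0. dist ((f (p + t *\<^sub>R a + t *\<^sub>R b) - f (p + t *\<^sub>R a) - f (p + t *\<^sub>R b) + f p) /\<^sub>R t\<^sup>2) (E p) < e"
    using d unfolding eventually_at_right_field by blast
qed

lemma has_vector_derivative_along_line:
  fixes f :: "'a::real_normed_vector \<Rightarrow> 'b::real_normed_vector"
  assumes "f differentiable (at (x + t *\<^sub>R a))"
  shows "((\<lambda>t. f (x + t *\<^sub>R a)) has_vector_derivative frechet_derivative f (at (x + t *\<^sub>R a)) a) (at t)"
proof -
  have f: "(f has_derivative frechet_derivative f (at (x + t *\<^sub>R a))) (at (x + t *\<^sub>R a))"
    using assms frechet_derivative_works by blast
  have "((\<lambda>t. x + t *\<^sub>R a) has_derivative (\<lambda>h. h *\<^sub>R a)) (at t)"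
    by (auto intro!: derivative_eq_intros)
  from has_derivative_compose[OF this f] show ?thesis
    unfolding has_vector_derivative_def
    by (simp add: linear_cmul[OF has_derivative_linear[OF f]])
qed

lemma mixed_directional_derivatives_commute:
  fixes f :: "'a::real_normed_vector \<Rightarrow> 'b::real_normed_vector"
  assumes S: "open S" "p \<in> S"
    and f: "\<And>x. x \<in> S \<Longrightarrow> f differentiable (at x)"
    and fa: "\<And>x. x \<in> S \<Longrightarrow> (\<lambda>x. frechet_derivative f (at x) a) differentiable (at x)"
    and fb: "\<And>x. x \<in> S \<Longrightarrow> (\<lambda>x. frechet_derivative f (at x) b) differentiable (at x)"
    and cont: "isCont (\<lambda>x. frechet_derivative (\<lambda>x. frechet_derivative f (at x) a) (at x) b) p"
      "isCont (\<lambda>x. frechet_derivative (\<lambda>x. frechet_derivative f (at x) b) (at x) a) p"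
  shows "frechet_derivative (\<lambda>x. frechet_derivative f (at x) a) (at p) b =
         frechet_derivative (\<lambda>x. frechet_derivative f (at x) b) (at p) a"
proof (rule tendsto_unique)
  show "at_right (0::real) \<noteq> bot" by simp
  show "((\<lambda>t. (f (p + t *\<^sub>R a + t *\<^sub>R b) - f (p + t *\<^sub>R a) - f (p + t *\<^sub>R b) + f p) /\<^sub>R t\<^sup>2)
      \<longlongrightarrow> frechet_derivative (\<lambda>x. frechet_derivative f (at x) a) (at p) b) (at_right 0)"
    by (rule second_difference_quotient_tendsto[OF S _ _ cont(1)])
       (rule has_vector_derivative_along_line f fa | assumption)+
  have "((\<lambda>t. (f (p + t *\<^sub>R b + t *\<^sub>R a) - f (p + t *\<^sub>R b) - f (p + t *\<^sub>R a) + f p) /\<^sub>R t\<^sup>2)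
      \<longlongrightarrow> frechet_derivative (\<lambda>x. frechet_derivative f (at x) b) (at p) a) (at_right 0)"
    by (rule second_difference_quotient_tendsto[OF S _ _ cont(2)])
       (rule has_vector_derivative_along_line f fb | assumption)+
  then show "((\<lambda>t. (f (p + t *\<^sub>R a + t *\<^sub>R b) - f (p + t *\<^sub>R a) - f (p + t *\<^sub>R b) + f p) /\<^sub>R t\<^sup>2)
      \<longlongrightarrow> frechet_derivative (\<lambda>x. frechet_derivative f (at x) b) (at p) a) (at_right 0)"
    by (simp add: algebra_simps)
qed

lemma C2_on_mixed_partials:
  assumes "C2_on f S" "open S" "z \<in> S"
  shows "partial_y (partial_x f) z = partial_x (partial_y f) z"
proof -
  have "isCont (partial_y (partial_x f)) z" "isCont (partial_x (partial_y f)) z"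
    using assms by (auto simp: C2_on_def continuous_on_eq_continuous_at)
  with assms mixed_directional_derivatives_commute[of S z f 1 \<i>] show ?thesis
    unfolding C2_on_def partial_x_def[abs_def] partial_y_def[abs_def] by blast
qed

lemma complex_derivative_wirtinger:
  assumes "f differentiable (at z)"
  shows "(f has_derivative (\<lambda>v. wirtinger_z f z * v + wirtinger_zbar f z * cnj v)) (at z)"
proof -
  have f: "(f has_derivative frechet_derivative f (at z)) (at z)"
    using assms frechet_derivative_works by blast
  have "frechet_derivative f (at z) v = wirtinger_z f z * v + wirtinger_zbar f z * cnj v" for v
  proof -
    interpret linear "frechet_derivative f (at z)" by (rule has_derivative_linear[OF f])
    have "v = Re v *\<^sub>R 1 + Im v *\<^sub>R \<i>" by (simp add: complex_eq_iff)
    then have "frechet_derivative f (at z) v = Re v *\<^sub>R partial_x f z + Im v *\<^sub>R partial_y f z"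
      unfolding partial_x_def partial_y_def by (metis add scale)
    also have "\<dots> = wirtinger_z f z * v + wirtinger_zbar f z * cnj v"
      unfolding wirtinger_z_def wirtinger_zbar_def
      by (simp add: complex_eq_iff algebra_simps) (simp add: field_simps)
    finally show ?thesis .
  qed
  then show ?thesis using f by (rule_tac has_derivative_eq_rhs[OF f]) auto
qed

text \<open>
  The hypothesis says that the antilinear part of the real derivative vanishes.
\<close>

lemma cauchy_riemann_imp_field_differentiable:
  assumes "f differentiable (at z)" "partial_x f z + \<i> * partial_y f z = 0"
  shows "f field_differentiable (at z)"
proof -
  have "wirtinger_zbar f z = 0" using assms(2) by (simp add: wirtinger_zbar_def)
  then have "(f has_field_derivative wirtinger_z f z) (at z)"
    using complex_derivative_wirtinger[OF assms(1)] by (simp add: has_field_derivative_def)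
  then show ?thesis unfolding field_differentiable_def by blast
qed

lemma partials_half_lincomb:
  assumes "f differentiable (at z)" "g differentiable (at z)"
  shows "(\<lambda>z. (f z + c * g z) / 2) differentiable (at z)"
    and "partial_x (\<lambda>z. (f z + c * g z) / 2) z = (partial_x f z + c * partial_x g z) / 2"
    and "partial_y (\<lambda>z. (f z + c * g z) / 2) z = (partial_y f z + c * partial_y g z) / 2"
proof -
  have *: "((\<lambda>z. (f z + c * g z) / 2) has_derivative
      (\<lambda>v. (frechet_derivative f (at z) v + c * frechet_derivative g (at z) v) / 2)) (at z)"
    using assms unfolding frechet_derivative_works by (auto intro!: derivative_eq_intros)
  then show "(\<lambda>z. (f z + c * g z) / 2) differentiable (at z)" by (auto simp: differentiable_def)
  show "partial_x (\<lambda>z. (f z + c * g z) / 2) z = (partial_x f z + c * partial_x g z) / 2"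
    "partial_y (\<lambda>z. (f z + c * g z) / 2) z = (partial_y f z + c * partial_y g z) / 2"
    unfolding partial_x_def partial_y_def frechet_derivative_at[OF *, symmetric] by auto
qed

text \<open>
  The Cauchy--Riemann expression of \<open>f\<^sub>z\<close> is half the Laplacian of \<open>f\<close> plus a multiple of the
  difference of the two mixed partial derivatives.
\<close>

lemma wirtinger_z_holomorphic:
  assumes f: "harmonic_map_on f S" and S: "open S"
  shows "wirtinger_z f holomorphic_on S"
proof -
  have "wirtinger_z f field_differentiable (at z)" if z: "z \<in> S" for z
  proof -
    have C2: "C2_on f S" and lap: "partial_x (partial_x f) z + partial_y (partial_y f) z = 0"
      using f z by (auto simp: harmonic_map_on_def)
    have d: "partial_x f differentiable (at z)" "partial_y f differentiable (at z)"
      using C2 z by (auto simp: C2_on_def)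
    have eq: "wirtinger_z f = (\<lambda>z. (partial_x f z + (- \<i>) * partial_y f z) / 2)"
      by (auto simp: wirtinger_z_def fun_eq_iff)
    show ?thesis
      unfolding eq
    proof (rule cauchy_riemann_imp_field_differentiable)
      show "partial_x (\<lambda>z. (partial_x f z + (- \<i>) * partial_y f z) / 2) z +
        \<i> * partial_y (\<lambda>z. (partial_x f z + (- \<i>) * partial_y f z) / 2) z = 0"
        unfolding partials_half_lincomb(2,3)[OF d] C2_on_mixed_partials[OF C2 S z]
        using lap by (simp add: algebra_simps add_divide_distrib[symmetric])
    qed (rule partials_half_lincomb(1)[OF d])
  qed
  then show ?thesis by (simp add: field_differentiable_at_within holomorphic_on_def)
qed

lemma partial_cnj:
  assumes "f differentiable (at z)"
  shows "(\<lambda>z. cnj (f z)) differentiable (at z)"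
    and "partial_x (\<lambda>z. cnj (f z)) z = cnj (partial_x f z)"
    and "partial_y (\<lambda>z. cnj (f z)) z = cnj (partial_y f z)"
proof -
  have *: "((\<lambda>z. cnj (f z)) has_derivative (\<lambda>v. cnj (frechet_derivative f (at z) v))) (at z)"
    using assms unfolding frechet_derivative_works by (rule has_derivative_cnj)
  then show "(\<lambda>z. cnj (f z)) differentiable (at z)" by (auto simp: differentiable_def)
  show "partial_x (\<lambda>z. cnj (f z)) z = cnj (partial_x f z)"
     "partial_y (\<lambda>z. cnj (f z)) z = cnj (partial_y f z)"
    unfolding partial_x_def partial_y_def frechet_derivative_at[OF *, symmetric] by auto
qed

lemma cnj_wirtinger_zbar_holomorphic:
  assumes f: "harmonic_map_on f S" and S: "open S"
  shows "(\<lambda>z. cnj (wirtinger_zbar f z)) holomorphic_on S"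
proof -
  have "(\<lambda>z. cnj (wirtinger_zbar f z)) field_differentiable (at z)" if z: "z \<in> S" for z
  proof -
    have C2: "C2_on f S" and lap: "partial_x (partial_x f) z + partial_y (partial_y f) z = 0"
      using f z by (auto simp: harmonic_map_on_def)
    have d: "partial_x f differentiable (at z)" "partial_y f differentiable (at z)"
      using C2 z by (auto simp: C2_on_def)
    note dc = partial_cnj(1)[OF d(1)] partial_cnj(1)[OF d(2)]
    have eq: "(\<lambda>z. cnj (wirtinger_zbar f z)) = (\<lambda>z. (cnj (partial_x f z) + (- \<i>) * cnj (partial_y f z)) / 2)"
      by (auto simp: wirtinger_zbar_def fun_eq_iff)
    show ?thesis
      unfolding eq
    proof (rule cauchy_riemann_imp_field_differentiable)
      have "cnj (partial_x (partial_x f) z) + cnj (partial_y (partial_y f) z) = 0"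
        using lap by (metis complex_cnj_add complex_cnj_zero)
      then show "partial_x (\<lambda>z. (cnj (partial_x f z) + (- \<i>) * cnj (partial_y f z)) / 2) z +
        \<i> * partial_y (\<lambda>z. (cnj (partial_x f z) + (- \<i>) * cnj (partial_y f z)) / 2) z = 0"
        unfolding partials_half_lincomb(2,3)[OF dc] partial_cnj(2,3)[OF d(1)] partial_cnj(2,3)[OF d(2)]
          C2_on_mixed_partials[OF C2 S z]
        by (simp add: algebra_simps add_divide_distrib[symmetric])
    qed (rule partials_half_lincomb(1)[OF dc])
  qed
  then show ?thesis by (simp add: field_differentiable_at_within holomorphic_on_def)
qed

text \<open>
  Take primitives \<open>h\<close> and \<open>g\<close> of the two holomorphic functions: \<open>f\<close> and \<open>h + cnj g\<close> have the same real
  derivative, hence differ by a constant, which is absorbed into \<open>h\<close>.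
\<close>

lemma harmonic_map_decomposition:
  assumes f: "harmonic_map_on f S" and S: "open S" "convex S"
  obtains h g where "h holomorphic_on S" "g holomorphic_on S"
    "\<And>z. z \<in> S \<Longrightarrow> f z = h z + cnj (g z)"
    "\<And>z. z \<in> S \<Longrightarrow> deriv h z = wirtinger_z f z"
    "\<And>z. z \<in> S \<Longrightarrow> deriv g z = cnj (wirtinger_zbar f z)"
proof -
  obtain h where h: "\<And>z. z \<in> S \<Longrightarrow> (h has_field_derivative wirtinger_z f z) (at z within S)"
    using holomorphic_convex_primitive'[OF S(2,1) wirtinger_z_holomorphic[OF f S(1)]] by blast
  obtain g where g: "\<And>z. z \<in> S \<Longrightarrow> (g has_field_derivative cnj (wirtinger_zbar f z)) (at z within S)"
    using holomorphic_convex_primitive'[OF S(2,1) cnj_wirtinger_zbar_holomorphic[OF f S(1)]] by blast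
  have "((\<lambda>z. f z - h z - cnj (g z)) has_derivative (\<lambda>v. 0)) (at z within S)" if z: "z \<in> S" for z
  proof -
    have "f differentiable (at z)" using f z by (auto simp: harmonic_map_on_def C2_on_def)
    note df = has_derivative_at_withinI[OF complex_derivative_wirtinger[OF this], of S]
    have "((\<lambda>z. f z - h z - cnj (g z)) has_derivative
        (\<lambda>v. (wirtinger_z f z * v + wirtinger_zbar f z * cnj v) - wirtinger_z f z * v
          - cnj (cnj (wirtinger_zbar f z) * v))) (at z within S)"
      by (intro has_derivative_diff has_derivative_cnj df
           h[OF z, unfolded has_field_derivative_def] g[OF z, unfolded has_field_derivative_def])
    then show ?thesis by simp
  qed
  then have "\<exists>c. \<forall>z\<in>S. f z - h z - cnj (g z) = c"
    by (rule has_derivative_zero_constant[OF S(2)])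
  then obtain c where c: "\<And>z. z \<in> S \<Longrightarrow> f z - h z - cnj (g z) = c" by blast
  have hol: "h holomorphic_on S" "g holomorphic_on S"
    using h g unfolding holomorphic_on_def field_differentiable_def by blast+
  show ?thesis
  proof (rule that[of "\<lambda>z. h z + c" g])
    show "(\<lambda>z. h z + c) holomorphic_on S" "g holomorphic_on S"
      using hol by (intro holomorphic_intros, simp_all)
    fix z assume z: "z \<in> S"
    show "f z = h z + c + cnj (g z)" using c[OF z] by (simp add: algebra_simps)
    have "((\<lambda>z. h z + c) has_field_derivative wirtinger_z f z + 0) (at z)"
      using h[OF z] unfolding at_within_open[OF z S(1)] by (intro DERIV_add DERIV_const)
    then show "deriv (\<lambda>z. h z + c) z = wirtinger_z f z" by (simp add: DERIV_imp_deriv)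
    show "deriv g z = cnj (wirtinger_zbar f z)"
      using g[OF z] unfolding at_within_open[OF z S(1)] by (rule DERIV_imp_deriv)
  qed
qed

section \<open>The lower bound\<close>

text \<open>
  Every \<open>h + \<epsilon> g\<close> with \<open>\<bar>\<epsilon>\<bar> = 1\<close> satisfies the holomorphic theorem with the same \<open>m\<close> and \<open>M\<close>. The
  lower estimate is the reverse triangle inequality, which covers sense-preserving and
  sense-reversing mappings alike.
\<close>

lemma harmonic_john_univalence:
  assumes f: "harmonic_map_on f unit_disk"
    and m: "0 < m" "\<And>z. z \<in> unit_disk \<Longrightarrow> m \<le> lambda_min f z"
    and M: "\<And>z. z \<in> unit_disk \<Longrightarrow> Lambda_max f z \<le> M" and ratio: "M < exp (pi / 2) * m"
  shows "inj_on f unit_disk"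
proof (rule inj_onI)
  fix x y assume xy: "x \<in> unit_disk" "y \<in> unit_disk" "f x = f y"
  obtain h g where hol: "h holomorphic_on unit_disk" "g holomorphic_on unit_disk"
    and fhg: "\<And>z. z \<in> unit_disk \<Longrightarrow> f z = h z + cnj (g z)"
    and dh: "\<And>z. z \<in> unit_disk \<Longrightarrow> deriv h z = wirtinger_z f z"
    and dg: "\<And>z. z \<in> unit_disk \<Longrightarrow> deriv g z = cnj (wirtinger_zbar f z)"
    using harmonic_map_decomposition[OF f open_ball convex_ball] by metis
  have inj: "inj_on (\<lambda>z. h z + \<epsilon> * g z) unit_disk" if \<epsilon>: "cmod \<epsilon> = 1" for \<epsilon>
  proof (rule analytic_john_univalence[OF _ _ m(1) ratio])
    show "(\<lambda>z. h z + \<epsilon> * g z) holomorphic_on unit_disk" by (intro holomorphic_intros hol)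
    fix z :: complex assume "cmod z < 1"
    then have z: "z \<in> unit_disk" by simp
    have "((\<lambda>z. h z + \<epsilon> * g z) has_field_derivative deriv h z + \<epsilon> * deriv g z) (at z)"
      by (intro DERIV_add DERIV_cmult holomorphic_derivI[OF _ open_ball z] hol)
    then have d: "deriv (\<lambda>z. h z + \<epsilon> * g z) z = wirtinger_z f z + \<epsilon> * cnj (wirtinger_zbar f z)"
      by (simp add: DERIV_imp_deriv dh[OF z] dg[OF z])
    have n: "cmod (\<epsilon> * cnj (wirtinger_zbar f z)) = cmod (wirtinger_zbar f z)"
      by (simp add: norm_mult \<epsilon>)
    show "m \<le> cmod (deriv (\<lambda>z. h z + \<epsilon> * g z) z) \<and> cmod (deriv (\<lambda>z. h z + \<epsilon> * g z) z) \<le> M"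
      using m(2)[OF z] M[OF z] norm_triangle_ineq[of "wirtinger_z f z" "\<epsilon> * cnj (wirtinger_zbar f z)"]
        norm_triangle_ineq3[of "wirtinger_z f z" "- (\<epsilon> * cnj (wirtinger_zbar f z))"]
      unfolding d lambda_min_def Lambda_max_def by (simp add: n)
  qed
  define D where "D = h x - h y"
  have D: "D = cnj (g y - g x)"
    using xy fhg[OF xy(1)] fhg[OF xy(2)] by (simp add: D_def algebra_simps)
  \<comment> \<open>The rotation that carries \<open>cnj D = g y - g x\<close> to \<open>D = h x - h y\<close>, so that the two values of
    \<open>h + \<epsilon> g\<close> agree. For \<open>D = 0\<close> any unimodular number serves.\<close>
  define \<epsilon> where "\<epsilon> = (if D = 0 then 1 else D / cnj D)"
  have "cmod \<epsilon> = 1" by (simp add: \<epsilon>_def norm_divide)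
  moreover have "g y - g x = cnj D" by (simp add: D)
  then have "h x - h y = \<epsilon> * (g y - g x)" unfolding D_def[symmetric] by (simp add: \<epsilon>_def)
  then have "h x + \<epsilon> * g x = h y + \<epsilon> * g y" by (simp add: algebra_simps)
  ultimately show "x = y" using inj xy(1,2) by (metis (no_types, lifting) inj_onD)
qed

lemma mu_ratio_less_imp_bounds:
  assumes "mu_ratio f < ereal K"
  obtains m M where "0 < m" "\<And>z. z \<in> unit_disk \<Longrightarrow> m \<le> lambda_min f z"
    "\<And>z. z \<in> unit_disk \<Longrightarrow> Lambda_max f z \<le> M" "M < K * m"
proof -
  have fin: "M_sup f \<noteq> \<infinity>" "m_inf f \<noteq> 0" and lt: "M_sup f / m_inf f < ereal K"
    using assms by (auto simp: mu_ratio_def split: if_splits)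
  have up: "ereal (Lambda_max f z) \<le> M_sup f" if "z \<in> unit_disk" for z
    unfolding M_sup_def by (rule SUP_upper[OF that])
  have lo: "m_inf f \<le> ereal (lambda_min f z)" if "z \<in> unit_disk" for z
    unfolding m_inf_def by (rule INF_lower[OF that])
  have "0 \<le> m_inf f"
    unfolding m_inf_def by (rule INF_greatest) (simp add: lambda_min_def)
  then obtain m where m: "m_inf f = ereal m" "m > 0"
    using fin(2) lo[of 0] by (cases "m_inf f") auto
  obtain M where M: "M_sup f = ereal M"
    using fin(1) up[of 0] by (cases "M_sup f") auto
  show ?thesis
    by (rule that[of m M]) (use up lo lt m M in \<open>auto simp: field_simps\<close>)
qed

lemma mu_ratio_le:
  assumes m: "0 < m" "\<And>z. z \<in> unit_disk \<Longrightarrow> m \<le> lambda_min f z"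
    and M: "\<And>z. z \<in> unit_disk \<Longrightarrow> Lambda_max f z \<le> M"
  shows "mu_ratio f \<le> ereal (M / m)"
proof -
  have M': "M_sup f \<le> ereal M" unfolding M_sup_def by (rule SUP_least) (use M in simp)
  have m': "ereal m \<le> m_inf f" unfolding m_inf_def by (rule INF_greatest) (use m in simp)
  have "ereal (Lambda_max f 0) \<le> M_sup f" unfolding M_sup_def by (rule SUP_upper) simp
  moreover have "0 \<le> Lambda_max f 0" by (simp add: Lambda_max_def)
  ultimately obtain a where a: "M_sup f = ereal a" "0 \<le> a" "a \<le> M"
    using M' by (cases "M_sup f") auto
  have "m_inf f \<le> ereal (lambda_min f 0)" unfolding m_inf_def by (rule INF_lower) simp
  then obtain b where b: "m_inf f = ereal b" "m \<le> b"
    using m' by (cases "m_inf f") auto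
  have "a / b \<le> M / m" using a b m by (intro frac_le) auto
  then show ?thesis using a b m by (simp add: mu_ratio_def)
qed

lemma exp_half_pi_le_harmonic_john_constant: "ereal (exp (pi / 2)) \<le> harmonic_john_constant"
  unfolding harmonic_john_constant_def
proof (rule INF_greatest)
  fix f assume f: "f \<in> nonconst_harmonic_maps - univalent_harmonic_maps"
  show "ereal (exp (pi / 2)) \<le> mu_ratio f"
  proof (rule ccontr)
    assume "\<not> ereal (exp (pi / 2)) \<le> mu_ratio f"
    then obtain m M where "0 < m" "\<And>z. z \<in> unit_disk \<Longrightarrow> m \<le> lambda_min f z"
      "\<And>z. z \<in> unit_disk \<Longrightarrow> Lambda_max f z \<le> M" "M < exp (pi / 2) * m"
      using mu_ratio_less_imp_bounds[of f "exp (pi / 2)"] by (metis not_le)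
    moreover have "harmonic_map_on f unit_disk" using f by (simp add: nonconst_harmonic_maps_def)
    ultimately have "inj_on f unit_disk" using harmonic_john_univalence by blast
    then show False
      using f by (auto simp: nonconst_harmonic_maps_def univalent_harmonic_maps_def)
  qed
qed


section \<open>The upper bound\<close>

lemma partials_if_eq_holomorphic:
  assumes g: "g holomorphic_on S" and S: "open S" and eq: "\<And>z. z \<in> S \<Longrightarrow> f z = g z" and z: "z \<in> S"
  shows "f differentiable (at z)" "partial_x f z = deriv g z" "partial_y f z = \<i> * deriv g z"
proof -
  have "(f has_field_derivative deriv g z) (at z)"
    by (rule has_field_derivative_transform_within_open[OF holomorphic_derivI[OF g S z] S z]) (simp add: eq)
  then have *: "(f has_derivative (\<lambda>v. deriv g z * v)) (at z)"
    by (simp add: has_field_derivative_def)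
  then show "f differentiable (at z)" by (auto simp: differentiable_def)
  show "partial_x f z = deriv g z" "partial_y f z = \<i> * deriv g z"
    unfolding partial_x_def partial_y_def frechet_derivative_at[OF *, symmetric] by auto
qed

lemma holomorphic_imp_harmonic_map_on:
  assumes f: "f holomorphic_on S" and S: "open S"
  shows "harmonic_map_on f S"
proof -
  have f': "deriv f holomorphic_on S" by (rule holomorphic_deriv[OF f S])
  have if': "(\<lambda>z. \<i> * deriv f z) holomorphic_on S" by (intro holomorphic_intros f')
  have dif': "deriv (\<lambda>z. \<i> * deriv f z) z = \<i> * deriv (deriv f) z" if "z \<in> S" for z
    by (intro DERIV_imp_deriv DERIV_cmult holomorphic_derivI[OF f' S that])
  note 1 = partials_if_eq_holomorphic[OF f S refl]
  note 2 = partials_if_eq_holomorphic[OF f' S 1(2)]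
  note 3 = partials_if_eq_holomorphic[OF if' S 1(3)]
  have "continuous_on S (deriv (deriv f))"
    by (intro holomorphic_on_imp_continuous_on holomorphic_deriv f' S)
  then have "continuous_on S (partial_x (partial_x f))" "continuous_on S (partial_x (partial_y f))"
    "continuous_on S (partial_y (partial_x f))" "continuous_on S (partial_y (partial_y f))"
    by (auto simp: 2(2,3) 3(2,3) dif' intro!: continuous_intros cong: continuous_on_cong)
  then show ?thesis
    using 1(1) 2(1) 3(1) by (auto simp: harmonic_map_on_def C2_on_def 2(2) 3(3) dif')
qed

lemma wirtinger_holomorphic:
  assumes "f holomorphic_on S" "open S" "z \<in> S"
  shows "wirtinger_z f z = deriv f z" "wirtinger_zbar f z = 0"
  using partials_if_eq_holomorphic[OF assms(1,2) refl assms(3)]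
  by (simp_all add: wirtinger_z_def wirtinger_zbar_def)

text \<open>
  With \<open>c = 1 + \<i> \<alpha>\<close>, the function is \<open>exp (c * Ln (1 + z))\<close>, and two values coincide when the logarithms differ
  by \<open>2 pi \<i> / c = 2 \<alpha> \<theta> + 2 \<theta> \<i>\<close>, where \<open>\<theta> = pi / (1 + \<alpha>\<^sup>2)\<close>. The assumption \<open>\<alpha> > 1\<close> is equivalent to
  \<open>\<theta> < pi / 2\<close> for positive \<open>\<alpha>\<close>, so points with arguments \<open>\<theta>\<close> and \<open>- \<theta>\<close> exist in the half-plane; scaling
  them down moves them into the disk with centre 1 and radius 1.
\<close>

lemma spiral_power_not_inj:
  assumes \<alpha>: "1 < \<alpha>"
  shows "\<not> inj_on (\<lambda>z. (1 + z) powr (1 + \<i> * of_real \<alpha>)) unit_disk"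
proof
  assume inj: "inj_on (\<lambda>z. (1 + z) powr (1 + \<i> * of_real \<alpha>)) unit_disk"
  define c where "c = 1 + \<i> * complex_of_real \<alpha>"
  define \<theta> where "\<theta> = pi / (1 + \<alpha>\<^sup>2)"
  have \<alpha>2: "1 < \<alpha>\<^sup>2" using \<alpha> by (simp add: one_less_power)
  then have \<theta>: "0 < \<theta>" "\<theta> < pi / 2" by (auto simp: \<theta>_def field_simps)
  have cos: "0 < cos \<theta>" using \<theta> by (simp add: cos_gt_zero)
  \<comment> \<open>The disk with centre 1 and radius 1 is \<open>r < 2 cos t\<close> in polar coordinates, so the radius
    \<open>exp s = cos \<theta>\<close> and all smaller ones are inside for the arguments \<open>\<theta>\<close> and \<open>- \<theta>\<close>.\<close>
  define s where "s = ln (cos \<theta>)"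
  have in_disk: "exp (Complex r t) - 1 \<in> unit_disk \<and> Ln (exp (Complex r t)) = Complex r t"
    if "r \<le> s" "\<bar>t\<bar> = \<theta>" for r t
  proof
    have e: "exp r \<le> cos \<theta>" using that(1) cos unfolding s_def by (metis exp_le_cancel_iff exp_ln)
    have ct: "cos t = cos \<theta>" using that(2) by (metis cos_abs_real)
    have "(cmod (exp (Complex r t) - 1))\<^sup>2 = (exp r * cos t - 1)\<^sup>2 + (exp r * sin t)\<^sup>2"
      by (simp add: cmod_power2 Re_exp Im_exp)
    also have "\<dots> = (exp r)\<^sup>2 * ((cos t)\<^sup>2 + (sin t)\<^sup>2) - 2 * exp r * cos \<theta> + 1"
      by (simp only: ct) (simp add: algebra_simps power2_eq_square)
    also have "\<dots> = exp r * (exp r - 2 * cos \<theta>) + 1"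
      by (simp only: sin_cos_squared_add2) (simp add: algebra_simps power2_eq_square)
    also have "\<dots> < 1" using e cos by (simp add: mult_pos_neg)
    finally have "cmod (exp (Complex r t) - 1) < 1" by (simp add: power_less_one_iff)
    then show "exp (Complex r t) - 1 \<in> unit_disk" by (simp add: dist_norm norm_minus_commute)
    show "Ln (exp (Complex r t)) = Complex r t"
      by (rule Ln_exp) (use that \<theta> in auto)
  qed
  define p where "p = Complex s \<theta>"
  define q where "q = Complex (s - 2 * \<alpha> * \<theta>) (- \<theta>)"
  have p: "exp p - 1 \<in> unit_disk" "Ln (exp p) = p" using in_disk[of s \<theta>] \<theta> by (auto simp: p_def)
  have q: "exp q - 1 \<in> unit_disk" "Ln (exp q) = q"
    using in_disk[of "s - 2 * \<alpha> * \<theta>" "- \<theta>"] \<theta> \<alpha> by (auto simp: q_def)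
  have t2: "\<theta> + \<alpha> * (\<alpha> * \<theta>) = pi"
  proof -
    have "\<theta> * (1 + \<alpha>\<^sup>2) = pi" using \<alpha>2 by (simp add: \<theta>_def)
    then show ?thesis by (simp add: algebra_simps power2_eq_square)
  qed
  then have "c * p = c * q + 2 * of_real pi * \<i>"
    by (simp add: c_def p_def q_def complex_eq_iff algebra_simps)
  then have "exp (c * p) = exp (c * q)" by (simp add: exp_add exp_two_pi_i)
  then have "(1 + (exp p - 1)) powr c = (1 + (exp q - 1)) powr c"
    by (simp add: powr_def p(2) q(2))
  then have "exp p - 1 = exp q - 1"
    using inj_onD[OF inj, of "exp p - 1" "exp q - 1"] p(1) q(1) by (simp add: c_def)
  then have "exp p = exp q" by (metis diff_add_cancel)
  then have "Ln (exp p) = Ln (exp q)" by (rule arg_cong)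
  then have "p = q" unfolding p(2) q(2) .
  then show False using \<theta> by (simp add: p_def q_def)
qed

text \<open>
  The derivative is a constant times \<open>(1 + z) powr (\<i> \<alpha>)\<close>, whose modulus depends only on the argument
  of \<open>1 + z\<close>, an angle strictly between \<open>- pi / 2\<close> and \<open>pi / 2\<close>.
\<close>

lemma mu_ratio_spiral_power:
  assumes \<alpha>: "1 < \<alpha>"
  shows "(\<lambda>z. (1 + z) powr (1 + \<i> * of_real \<alpha>)) holomorphic_on unit_disk"
    and "mu_ratio (\<lambda>z. (1 + z) powr (1 + \<i> * of_real \<alpha>)) \<le> ereal (exp (\<alpha> * pi))"
proof -
  let ?f = "\<lambda>z::complex. (1 + z) powr (1 + \<i> * of_real \<alpha>)"
  have half_plane: "0 < Re (1 + z)" if "z \<in> unit_disk" for z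
    using that abs_Re_le_cmod[of z] by auto
  have der: "(?f has_field_derivative (1 + \<i> * of_real \<alpha>) * (1 + z) powr (\<i> * of_real \<alpha>)) (at z)"
    if "z \<in> unit_disk" for z
    using half_plane[OF that] by (auto intro!: derivative_eq_intros simp: complex_nonpos_Reals_iff)
  show hol: "?f holomorphic_on unit_disk"
    unfolding holomorphic_on_open[OF open_ball] using der by blast
  define C where "C = cmod (1 + \<i> * of_real \<alpha>)"
  have C: "C > 0" unfolding C_def by (auto simp: complex_eq_iff)
  have nd: "cmod (deriv ?f z) = C * exp (- \<alpha> * Im (Ln (1 + z)))" if "z \<in> unit_disk" for z
  proof -
    have "1 + z \<noteq> 0" using half_plane[OF that] by (metis less_irrefl zero_complex.sel(1))
    then have "cmod ((1 + z) powr (\<i> * of_real \<alpha>)) = exp (- \<alpha> * Im (Ln (1 + z)))"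
      by (simp add: powr_def)
    then show ?thesis by (simp add: DERIV_imp_deriv[OF der[OF that]] norm_mult C_def)
  qed
  have Im: "\<bar>\<alpha> * Im (Ln (1 + z))\<bar> \<le> \<alpha> * (pi / 2)" if "z \<in> unit_disk" for z
    using half_plane[OF that] \<alpha> Re_Ln_pos_lt[of "1 + z"]
    by (auto simp: abs_mult complex_eq_iff intro!: mult_left_mono)
  have "mu_ratio ?f \<le> ereal (C * exp (\<alpha> * (pi / 2)) / (C * exp (- (\<alpha> * (pi / 2)))))"
  proof (rule mu_ratio_le)
    fix z :: complex assume z: "z \<in> unit_disk"
    note w = wirtinger_holomorphic[OF hol open_ball z]
    show "C * exp (- (\<alpha> * (pi / 2))) \<le> lambda_min ?f z"
      using Im[OF z] C by (simp add: lambda_min_def w nd[OF z])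
    show "Lambda_max ?f z \<le> C * exp (\<alpha> * (pi / 2))"
      using Im[OF z] C by (simp add: Lambda_max_def w nd[OF z])
  qed (use C in simp)
  also have "C * exp (\<alpha> * (pi / 2)) / (C * exp (- (\<alpha> * (pi / 2)))) = exp (\<alpha> * pi)"
    using C by (simp add: exp_minus field_simps flip: exp_add)
  finally show "mu_ratio ?f \<le> ereal (exp (\<alpha> * pi))" .
qed

lemma harmonic_john_constant_le_exp_pi: "harmonic_john_constant \<le> ereal (exp pi)"
proof (rule tendsto_lowerbound)
  have "((\<lambda>\<alpha>. exp (\<alpha> * pi)) \<longlongrightarrow> exp (1 * pi)) (at_right 1)" by (intro tendsto_intros)
  then show "((\<lambda>\<alpha>. ereal (exp (\<alpha> * pi))) \<longlongrightarrow> ereal (exp pi)) (at_right 1)" by simp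
  have "harmonic_john_constant \<le> ereal (exp (\<alpha> * pi))" if \<alpha>: "1 < \<alpha>" for \<alpha>
  proof -
    let ?f = "\<lambda>z::complex. (1 + z) powr (1 + \<i> * of_real \<alpha>)"
    have "harmonic_map_on ?f unit_disk"
      by (rule holomorphic_imp_harmonic_map_on[OF mu_ratio_spiral_power(1)[OF \<alpha>] open_ball])
    moreover have "\<not> ?f constant_on unit_disk"
    proof
      assume "?f constant_on unit_disk"
      then obtain y where y: "\<And>z. z \<in> unit_disk \<Longrightarrow> ?f z = y"
        unfolding constant_on_def by blast
      have "?f 0 = ?f (- 1 / 2)"
        by (rule trans[OF y sym[OF y]]) (simp_all add: norm_divide)
      moreover have "cmod (?f (- 1 / 2)) = 1 / 2"
      proof -
        have "cmod (complex_of_real (1 / 2) powr (1 + \<i> * of_real \<alpha>)) = (1 / 2) powr 1"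
          by (subst norm_powr_real_powr) simp_all
        then show ?thesis by simp
      qed
      ultimately show False by simp
    qed
    ultimately have "?f \<in> nonconst_harmonic_maps - univalent_harmonic_maps"
      using spiral_power_not_inj[OF \<alpha>]
      by (simp add: nonconst_harmonic_maps_def univalent_harmonic_maps_def)
    then have "harmonic_john_constant \<le> mu_ratio ?f"
      unfolding harmonic_john_constant_def by (rule INF_lower)
    also have "\<dots> \<le> ereal (exp (\<alpha> * pi))" by (rule mu_ratio_spiral_power(2)[OF \<alpha>])
    finally show ?thesis .
  qed
  then show "\<forall>\<^sub>F \<alpha> in at_right 1. harmonic_john_constant \<le> ereal (exp (\<alpha> * pi))"
    by (auto simp: eventually_at_filter)
qed simp

theorem theorem2:
  shows "ereal (exp (pi / 2)) \<le> harmonic_john_constant \<and>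
         harmonic_john_constant \<le> ereal (exp pi)"
  using exp_half_pi_le_harmonic_john_constant harmonic_john_constant_le_exp_pi by blast

end
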